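(* Let $(M,\varphi,\xi,\eta,g)$ be a $(2n+1)$-dimensional para-Sasaki-like Riemannian manifold, let $\alpha,\beta$ be constants, and let $\overline{\nabla}$ be the generalized symmetric metric connection on $M$ determined by $\alpha,\beta$. Let $\mathrm{Ric}$ and $\overline{\mathrm{Ric}}$ be the Ricci tensors of the Levi-Civita connection $\nabla$ and of $\overline{\nabla}$, respectively. Then for all vector fields $x,y$ on $M$: $$\begin{aligned} \overline{\mathrm{Ric}}(x,y)={}&\mathrm{Ric}(x,y)+[\beta^2-\beta+(1-2n)\alpha^2]\,g(x,y)\\ &+[(2n+1)\beta-\beta^2+(2n-1)\alpha^2]\,\eta(x)\eta(y)\\ &+[(\alpha\beta-\alpha)(2-2n)+\alpha]\,g(x,\varphi y). \end{aligned}$$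
   Context: An almost paracontact almost paracomplex Riemannian manifold (apapR manifold) $(M,\varphi,\xi,\eta,g)$ is a differentiable manifold $M$ of dimension $2n+1$ with a $(1,1)$-tensor field $\varphi$, a vector field $\xi$, a $1$-form $\eta$ and a Riemannian metric $g$ such that, for all vector fields $x,y$: $\eta(\xi)=1$, $\varphi^2x=x-\eta(x)\xi$, $\varphi\xi=0$, $g(\varphi x,\varphi y)=g(x,y)-\eta(x)\eta(y)$, $\mathrm{tr}\,\varphi=0$. Consequently $g(x,\xi)=\eta(x)$ and $g(x,\varphi y)=g(\varphi x,y)$. With $\nabla$ the Levi-Civita connection of $g$, the apapR manifold is called para-Sasaki-like if $(\nabla_x\varphi)y=-g(x,y)\xi-\eta(y)x+2\eta(x)\eta(y)\xi$ for all vector fields $x,y$. The generalized symmetric metric connection determined by $\alpha,\beta$ is $$\overline{\nabla}_xy=\nabla_xy+\alpha\{g(x,y)\xi-\eta(y)x\}+\beta\{g(\varphi x,y)\xi-\eta(y)\varphi x\}.$$ Conventions: $\overline{R}(x,y)z=\overline{\nabla}_x\overline{\nabla}_yz-\overline{\nabla}_y\overline{\nabla}_xz-\overline{\nabla}_{[x,y]}z$, $\overline{R}(x,y,z,w)=g(\overline{R}(x,y)z,w)$, and $\overline{\mathrm{Ric}}(x,y)=\sum_{i=0}^{2n}\overline{R}(e_i,x,y,e_i)$ for an orthonormal basis $\{e_0=\xi,e_1,\ldots,e_{2n}\}$ of the tangent space; likewise $R$ and $\mathrm{Ric}$ with $\nabla$. *)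

theory Defs
  imports "HOL-Analysis.Analysis"
begin

section \<open>Smooth functions on open subsets of Euclidean space\<close>

primrec Ck_on :: "nat \<Rightarrow> 'a::euclidean_space set \<Rightarrow> ('a \<Rightarrow> 'b::real_normed_vector) \<Rightarrow> bool" where
  "Ck_on 0 S f \<longleftrightarrow> continuous_on S f"
| "Ck_on (Suc k) S f \<longleftrightarrow>
     (\<forall>x\<in>S. f differentiable (at x)) \<and>
     (\<forall>v. Ck_on k S (\<lambda>x. frechet_derivative f (at x) v))"

definition smooth_on :: "'a::euclidean_space set \<Rightarrow> ('a \<Rightarrow> 'b::real_normed_vector) \<Rightarrow> bool" where
  "smooth_on S f \<longleftrightarrow> (\<forall>k. Ck_on k S f)"


section \<open>Smooth manifolds\<close>

text \<open>
  The manifold is a whole type \<open>'m\<close> and its smooth structure is given by a (not necessarily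
  maximal) atlas of charts into a Euclidean space \<open>'e\<close>; the dimension of the manifold is
  \<open>DIM('e)\<close>. A chart is a pair of its domain and its coordinate map; the values of the
  coordinate map outside the domain are irrelevant.
\<close>

type_synonym ('m, 'e) chart = "'m set \<times> ('m \<Rightarrow> 'e)"

definition chart_inv :: "('m, 'e) chart \<Rightarrow> 'e \<Rightarrow> 'm" where
  "chart_inv K = inv_into (fst K) (snd K)"

definition chart_image :: "('m, 'e) chart \<Rightarrow> 'e set" where
  "chart_image K = snd K ` fst K"

definition is_chart :: "('m::topological_space, 'e::euclidean_space) chart \<Rightarrow> bool" where
  "is_chart K \<longleftrightarrow> open (fst K) \<and> open (chart_image K) \<and>
     homeomorphism (fst K) (chart_image K) (snd K) (chart_inv K)"

definition smooth_atlas ::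
  "('m::{t2_space, second_countable_topology}, 'e::euclidean_space) chart set \<Rightarrow> bool" where
  "smooth_atlas A \<longleftrightarrow>
     (\<forall>K\<in>A. is_chart K) \<and>
     (\<Union>K\<in>A. fst K) = UNIV \<and>
     (\<forall>K\<in>A. \<forall>L\<in>A. smooth_on (snd K ` (fst K \<inter> fst L)) (snd L \<circ> chart_inv K))"

definition smooth_fun :: "('m, 'e::euclidean_space) chart set \<Rightarrow> ('m \<Rightarrow> real) \<Rightarrow> bool" where
  "smooth_fun A f \<longleftrightarrow> (\<forall>K\<in>A. smooth_on (chart_image K) (f \<circ> chart_inv K))"


section \<open>Tangent vectors and vector fields\<close>

text \<open>
  The tangent space at \<open>p\<close> is identified with \<open>'e\<close> by means of the coordinates of one fixed
  chart around \<open>p\<close>, namely \<open>chart_at A p\<close>. This chart may jump as \<open>p\<close> varies, so smoothness of a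
  vector field is tested on its components \<open>comps\<close> with respect to the charts of the atlas.
\<close>

definition chart_at :: "('m, 'e) chart set \<Rightarrow> 'm \<Rightarrow> ('m, 'e) chart" where
  "chart_at A p = (SOME K. K \<in> A \<and> p \<in> fst K)"

definition coord_at :: "('m, 'e) chart set \<Rightarrow> 'm \<Rightarrow> 'e" where
  "coord_at A p = snd (chart_at A p) p"

text \<open>The components in the chart \<open>K\<close> of the tangent vector \<open>v\<close> at \<open>p\<close>:\<close>

definition comps ::
  "('m, 'e::euclidean_space) chart set \<Rightarrow> ('m, 'e) chart \<Rightarrow> 'm \<Rightarrow> 'e \<Rightarrow> 'e" where
  "comps A K p v = frechet_derivative (snd K \<circ> chart_inv (chart_at A p)) (at (coord_at A p)) v"

definition field_comps ::
  "('m, 'e::euclidean_space) chart set \<Rightarrow> ('m, 'e) chart \<Rightarrow> ('m \<Rightarrow> 'e) \<Rightarrow> 'e \<Rightarrow> 'e" where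
  "field_comps A K X y = comps A K (chart_inv K y) (X (chart_inv K y))"

definition vector_field :: "('m, 'e::euclidean_space) chart set \<Rightarrow> ('m \<Rightarrow> 'e) \<Rightarrow> bool" where
  "vector_field A X \<longleftrightarrow> (\<forall>K\<in>A. smooth_on (chart_image K) (field_comps A K X))"

text \<open>The derivative \<open>X f\<close> of a function along a vector field:\<close>

definition dir_deriv ::
  "('m, 'e::euclidean_space) chart set \<Rightarrow> ('m \<Rightarrow> 'e) \<Rightarrow> ('m \<Rightarrow> real) \<Rightarrow> 'm \<Rightarrow> real" where
  "dir_deriv A X f p =
     frechet_derivative (f \<circ> chart_inv (chart_at A p)) (at (coord_at A p)) (X p)"

text \<open>
  The Lie bracket by its coordinate formula \<open>[X,Y]\<^sup>i = X\<^sup>j \<partial>\<^sub>j Y\<^sup>i - Y\<^sup>j \<partial>\<^sub>j X\<^sup>i\<close>, evaluated at \<open>p\<close> in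
  the chart \<open>chart_at A p\<close>, in which the components of \<open>X\<close> at \<open>p\<close> are \<open>X p\<close> itself.
\<close>

definition lie_bracket ::
  "('m, 'e::euclidean_space) chart set \<Rightarrow> ('m \<Rightarrow> 'e) \<Rightarrow> ('m \<Rightarrow> 'e) \<Rightarrow> 'm \<Rightarrow> 'e" where
  "lie_bracket A X Y p =
     frechet_derivative (field_comps A (chart_at A p) Y) (at (coord_at A p)) (X p) -
     frechet_derivative (field_comps A (chart_at A p) X) (at (coord_at A p)) (Y p)"


section \<open>Tensor fields\<close>

text \<open>
  Tensor fields are families of (multi)linear maps on the tangent spaces; they are smooth if
  they send smooth vector fields to smooth functions or smooth vector fields.
\<close>

definition endo_field ::
  "('m, 'e::euclidean_space) chart set \<Rightarrow> ('m \<Rightarrow> 'e \<Rightarrow> 'e) \<Rightarrow> bool" where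
  "endo_field A \<phi> \<longleftrightarrow>
     (\<forall>p. linear (\<phi> p)) \<and>
     (\<forall>X. vector_field A X \<longrightarrow> vector_field A (\<lambda>p. \<phi> p (X p)))"

definition one_form ::
  "('m, 'e::euclidean_space) chart set \<Rightarrow> ('m \<Rightarrow> 'e \<Rightarrow> real) \<Rightarrow> bool" where
  "one_form A \<eta> \<longleftrightarrow>
     (\<forall>p. linear (\<eta> p)) \<and>
     (\<forall>X. vector_field A X \<longrightarrow> smooth_fun A (\<lambda>p. \<eta> p (X p)))"

definition riemannian_metric ::
  "('m, 'e::euclidean_space) chart set \<Rightarrow> ('m \<Rightarrow> 'e \<Rightarrow> 'e \<Rightarrow> real) \<Rightarrow> bool" where
  "riemannian_metric A g \<longleftrightarrow>
     (\<forall>p. bilinear (g p)) \<and>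
     (\<forall>p u v. g p u v = g p v u) \<and>
     (\<forall>p v. v \<noteq> 0 \<longrightarrow> g p v v > 0) \<and>
     (\<forall>X Y. vector_field A X \<longrightarrow> vector_field A Y \<longrightarrow> smooth_fun A (\<lambda>p. g p (X p) (Y p)))"

definition endo_trace :: "('e::euclidean_space \<Rightarrow> 'e) \<Rightarrow> real" where
  "endo_trace f = (\<Sum>b\<in>Basis. f b \<bullet> b)"


section \<open>Connections\<close>

text \<open>A connection \<open>D\<close> is only meaningful on (smooth) vector fields.\<close>

type_synonym ('m, 'e) connection = "('m \<Rightarrow> 'e) \<Rightarrow> ('m \<Rightarrow> 'e) \<Rightarrow> 'm \<Rightarrow> 'e"

definition affine_connection ::
  "('m, 'e::euclidean_space) chart set \<Rightarrow> ('m, 'e) connection \<Rightarrow> bool" where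
  "affine_connection A D \<longleftrightarrow>
     (\<forall>X Y. vector_field A X \<longrightarrow> vector_field A Y \<longrightarrow> vector_field A (D X Y)) \<and>
     (\<forall>X Y Z p. vector_field A X \<longrightarrow> vector_field A Y \<longrightarrow> vector_field A Z \<longrightarrow>
        D (\<lambda>q. X q + Y q) Z p = D X Z p + D Y Z p) \<and>
     (\<forall>f X Y p. smooth_fun A f \<longrightarrow> vector_field A X \<longrightarrow> vector_field A Y \<longrightarrow>
        D (\<lambda>q. f q *\<^sub>R X q) Y p = f p *\<^sub>R D X Y p) \<and>
     (\<forall>X Y Z p. vector_field A X \<longrightarrow> vector_field A Y \<longrightarrow> vector_field A Z \<longrightarrow>
        D X (\<lambda>q. Y q + Z q) p = D X Y p + D X Z p) \<and>
     (\<forall>f X Y p. smooth_fun A f \<longrightarrow> vector_field A X \<longrightarrow> vector_field A Y \<longrightarrow>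
        D X (\<lambda>q. f q *\<^sub>R Y q) p = dir_deriv A X f p *\<^sub>R Y p + f p *\<^sub>R D X Y p)"

definition torsion_free ::
  "('m, 'e::euclidean_space) chart set \<Rightarrow> ('m, 'e) connection \<Rightarrow> bool" where
  "torsion_free A D \<longleftrightarrow>
     (\<forall>X Y p. vector_field A X \<longrightarrow> vector_field A Y \<longrightarrow>
        D X Y p - D Y X p = lie_bracket A X Y p)"

definition metric_connection ::
  "('m, 'e::euclidean_space) chart set \<Rightarrow> ('m \<Rightarrow> 'e \<Rightarrow> 'e \<Rightarrow> real) \<Rightarrow> ('m, 'e) connection \<Rightarrow> bool" where
  "metric_connection A g D \<longleftrightarrow>
     (\<forall>X Y Z p. vector_field A X \<longrightarrow> vector_field A Y \<longrightarrow> vector_field A Z \<longrightarrow>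
        dir_deriv A X (\<lambda>q. g q (Y q) (Z q)) p = g p (D X Y p) (Z p) + g p (Y p) (D X Z p))"

definition levi_civita ::
  "('m, 'e::euclidean_space) chart set \<Rightarrow> ('m \<Rightarrow> 'e \<Rightarrow> 'e \<Rightarrow> real) \<Rightarrow> ('m, 'e) connection \<Rightarrow> bool" where
  "levi_civita A g D \<longleftrightarrow>
     affine_connection A D \<and> torsion_free A D \<and> metric_connection A g D"

definition curvature ::
  "('m, 'e::euclidean_space) chart set \<Rightarrow> ('m, 'e) connection \<Rightarrow>
   ('m \<Rightarrow> 'e) \<Rightarrow> ('m \<Rightarrow> 'e) \<Rightarrow> ('m \<Rightarrow> 'e) \<Rightarrow> 'm \<Rightarrow> 'e" where
  "curvature A D X Y Z p = D X (D Y Z) p - D Y (D X Z) p - D (lie_bracket A X Y) Z p"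

definition curvature4 ::
  "('m, 'e::euclidean_space) chart set \<Rightarrow> ('m \<Rightarrow> 'e \<Rightarrow> 'e \<Rightarrow> real) \<Rightarrow> ('m, 'e) connection \<Rightarrow>
   ('m \<Rightarrow> 'e) \<Rightarrow> ('m \<Rightarrow> 'e) \<Rightarrow> ('m \<Rightarrow> 'e) \<Rightarrow> ('m \<Rightarrow> 'e) \<Rightarrow> 'm \<Rightarrow> real" where
  "curvature4 A g D X Y Z W p = g p (curvature A D X Y Z p) (W p)"


section \<open>Almost paracontact almost paracomplex Riemannian manifolds\<close>

definition apapR_manifold ::
  "nat \<Rightarrow> ('m::{t2_space, second_countable_topology}, 'e::euclidean_space) chart set \<Rightarrow>
   ('m \<Rightarrow> 'e \<Rightarrow> 'e) \<Rightarrow> ('m \<Rightarrow> 'e) \<Rightarrow> ('m \<Rightarrow> 'e \<Rightarrow> real) \<Rightarrow> ('m \<Rightarrow> 'e \<Rightarrow> 'e \<Rightarrow> real) \<Rightarrow> bool" where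
  "apapR_manifold n A \<phi> \<xi> \<eta> g \<longleftrightarrow>
     DIM('e) = 2 * n + 1 \<and>
     smooth_atlas A \<and>
     endo_field A \<phi> \<and> vector_field A \<xi> \<and> one_form A \<eta> \<and> riemannian_metric A g \<and>
     (\<forall>p. \<eta> p (\<xi> p) = 1) \<and>
     (\<forall>p v. \<phi> p (\<phi> p v) = v - \<eta> p v *\<^sub>R \<xi> p) \<and>
     (\<forall>p. \<phi> p (\<xi> p) = 0) \<and>
     (\<forall>p u v. g p (\<phi> p u) (\<phi> p v) = g p u v - \<eta> p u * \<eta> p v) \<and>
     (\<forall>p. endo_trace (\<phi> p) = 0)"

definition para_Sasaki_like ::
  "('m, 'e::euclidean_space) chart set \<Rightarrow> ('m \<Rightarrow> 'e \<Rightarrow> 'e) \<Rightarrow> ('m \<Rightarrow> 'e) \<Rightarrow>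
   ('m \<Rightarrow> 'e \<Rightarrow> real) \<Rightarrow> ('m \<Rightarrow> 'e \<Rightarrow> 'e \<Rightarrow> real) \<Rightarrow> ('m, 'e) connection \<Rightarrow> bool" where
  "para_Sasaki_like A \<phi> \<xi> \<eta> g D \<longleftrightarrow>
     (\<forall>X Y p. vector_field A X \<longrightarrow> vector_field A Y \<longrightarrow>
        D X (\<lambda>q. \<phi> q (Y q)) p - \<phi> p (D X Y p) =
          - g p (X p) (Y p) *\<^sub>R \<xi> p - \<eta> p (Y p) *\<^sub>R X p
          + (2 * \<eta> p (X p) * \<eta> p (Y p)) *\<^sub>R \<xi> p)"

definition gen_sym_metric_connection ::
  "('m \<Rightarrow> 'e::euclidean_space \<Rightarrow> 'e) \<Rightarrow> ('m \<Rightarrow> 'e) \<Rightarrow> ('m \<Rightarrow> 'e \<Rightarrow> real) \<Rightarrow>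
   ('m \<Rightarrow> 'e \<Rightarrow> 'e \<Rightarrow> real) \<Rightarrow> ('m, 'e) connection \<Rightarrow> real \<Rightarrow> real \<Rightarrow> ('m, 'e) connection" where
  "gen_sym_metric_connection \<phi> \<xi> \<eta> g D \<alpha> \<beta> X Y p =
     D X Y p
     + \<alpha> *\<^sub>R (g p (X p) (Y p) *\<^sub>R \<xi> p - \<eta> p (Y p) *\<^sub>R X p)
     + \<beta> *\<^sub>R (g p (\<phi> p (X p)) (Y p) *\<^sub>R \<xi> p - \<eta> p (Y p) *\<^sub>R \<phi> p (X p))"

text \<open>
  Curvature acts on vector fields, so an orthonormal basis \<open>{\<xi> p, e\<^sub>1, \<dots>, e\<^sub>2\<^sub>n}\<close> of the tangent
  space at \<open>p\<close> enters through vector fields on the manifold that take the basis vectors as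
  values at \<open>p\<close>. Since curvature is tensorial, neither the extensions nor the chosen basis
  affect the value of the Ricci tensor.
\<close>

definition orthonormal_basis_at ::
  "nat \<Rightarrow> ('m \<Rightarrow> 'e::euclidean_space \<Rightarrow> 'e \<Rightarrow> real) \<Rightarrow> ('m \<Rightarrow> 'e) \<Rightarrow> 'm \<Rightarrow> (nat \<Rightarrow> 'e) \<Rightarrow> bool" where
  "orthonormal_basis_at n g \<xi> p e \<longleftrightarrow>
     e 0 = \<xi> p \<and>
     (\<forall>i\<le>2 * n. \<forall>j\<le>2 * n. g p (e i) (e j) = (if i = j then 1 else 0)) \<and>
     span (e ` {..2 * n}) = UNIV"

definition ricci ::
  "nat \<Rightarrow> ('m, 'e::euclidean_space) chart set \<Rightarrow> ('m \<Rightarrow> 'e \<Rightarrow> 'e \<Rightarrow> real) \<Rightarrow> ('m \<Rightarrow> 'e) \<Rightarrow>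
   ('m, 'e) connection \<Rightarrow> ('m \<Rightarrow> 'e) \<Rightarrow> ('m \<Rightarrow> 'e) \<Rightarrow> 'm \<Rightarrow> real" where
  "ricci n A g \<xi> D X Y p =
     (let E = (SOME E. (\<forall>i\<le>2 * n. vector_field A (E i)) \<and>
                       orthonormal_basis_at n g \<xi> p (\<lambda>i. E i p))
      in \<Sum>i\<le>2 * n. curvature4 A g D (E i) X Y (E i) p)"

end

theory Submission
  imports Defs
begin

text \<open>
  The new connection is \<open>D + S\<close> for a tensor \<open>S\<close>, so its curvature exceeds that of \<open>D\<close> by
  \<open>(D\<^sub>X S)(Y,Z) - (D\<^sub>Y S)(X,Z) + S(X,S(Y,Z)) - S(Y,S(X,Z))\<close>. The para-Sasaki-like condition yields
  \<open>D\<^sub>X \<xi> = \<phi> X\<close>, which makes \<open>D S\<close> explicit, and the result is traced over an orthonormal basis.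
  The choice in the definition of the Ricci tensor is the same for both connections; it is
  legitimate because every tangent vector extends to a global vector field, by bump functions.
\<close>

subsection \<open>Calculus of \<open>C\<^sup>k\<close> functions\<close>

text \<open>Since \<open>D\<close> is torsion-free, \<open>[X,Y]\<close> is
  \<open>D X Y - D Y X\<close>. Hence every term of the excess that still differentiates a vector
  field cancels, and what remains depends only on values at \<open>p\<close>. The trace is therefore
  a computation in one tangent space. For a basis vector \<open>a\<close>, each summand is a
  combination of \<open>g a a\<close>, \<open>g (\<phi> a) a\<close> and products of two linear
  pairings with \<open>a\<close>. Over the basis these sum to \<open>2n+1\<close>, \<open>0\<close>
  and, by Parseval, inner products of the fixed vectors. The analytic half is there because
  \<open>SOME\<close> says nothing about its value without a witness. It has to cope with two
  encodings: \<open>Ck_on\<close> recurses through the total \<open>frechet_derivative\<close>, and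
  a tangent vector at \<open>q\<close> is stored in a chart that may jump with \<open>q\<close>, so
  smoothness of a constructed field must be checked in every chart separately.\<close>

lemma frechet_derivative_cong_open:
  assumes "open S" "x \<in> S" "\<And>y. y \<in> S \<Longrightarrow> f y = h y"
  shows "frechet_derivative f (at x) = frechet_derivative h (at x)"
proof -
  have "(f has_derivative d) (at x) \<longleftrightarrow> (h has_derivative d) (at x)" for d
    using assms has_derivative_transform_within_open[of _ _ x UNIV S] by metis
  then show ?thesis
    unfolding frechet_derivative_def by simp
qed

lemma differentiable_cong_open:
  assumes "open S" "x \<in> S" "\<And>y. y \<in> S \<Longrightarrow> f y = h y" "f differentiable (at x)"
  shows "h differentiable (at x)"
  using assms has_derivative_transform_within_open[of f _ x UNIV S h]
  unfolding differentiable_def by blast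

lemma frechet_derivative_has_derivative:
  "f differentiable (at x) \<Longrightarrow> (f has_derivative frechet_derivative f (at x)) (at x)"
  by (simp add: frechet_derivative_works)

text \<open>On an open set equal values force equal derivatives, at every order. The product and
  chain rules below give the derivative only at points of \<open>S\<close>, whereas
  \<open>Ck_on\<close> speaks of the total \<open>frechet_derivative\<close>; this congruence
  bridges the two.\<close>

lemma Ck_on_cong:
  assumes "open S" "\<And>x. x \<in> S \<Longrightarrow> f x = h x" "Ck_on k S f"
  shows "Ck_on k S h"
  using assms(2,3)
proof (induction k arbitrary: f h)
  case 0
  then show ?case by (metis Ck_on.simps(1) continuous_on_cong)
next
  case (Suc k)
  have "h differentiable (at x)" if "x \<in> S" for x
    using differentiable_cong_open[OF assms(1) that Suc.prems(1)] Suc.prems(2) that by simp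
  moreover have "Ck_on k S (\<lambda>x. frechet_derivative h (at x) v)" for v
  proof (rule Suc.IH)
    show "Ck_on k S (\<lambda>x. frechet_derivative f (at x) v)"
      using Suc.prems(2) by simp
    show "frechet_derivative f (at x) v = frechet_derivative h (at x) v" if "x \<in> S" for x
      using frechet_derivative_cong_open[OF assms(1) that Suc.prems(1)] by simp
  qed
  ultimately show ?case by simp
qed

lemma Ck_on_SucD: "Ck_on (Suc k) S f \<Longrightarrow> Ck_on k S f"
proof (induction k arbitrary: f)
  case 0
  then show ?case
    by (auto intro!: continuous_at_imp_continuous_on differentiable_imp_continuous_within)
next
  case (Suc k)
  then show ?case using Ck_on.simps(2) by blast
qed

text \<open>Derivatives in \<open>Ck_on\<close> are taken in the full space, not relative to the
  set, so the neighbourhood that serves \<open>f\<close> also serves its directional derivatives.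
  Used to glue a field from two open pieces.\<close>

lemma Ck_on_local:
  assumes "\<And>x. x \<in> S \<Longrightarrow> \<exists>T. open T \<and> x \<in> T \<and> Ck_on k T f"
  shows "Ck_on k S f"
  using assms
proof (induction k arbitrary: f)
  case 0
  then show ?case
    by (metis Ck_on.simps(1) continuous_at_imp_continuous_on continuous_on_eq_continuous_at)
next
  case (Suc k)
  have "f differentiable (at x)" if "x \<in> S" for x
    using Suc.prems[OF that] by auto
  moreover have "Ck_on k S (\<lambda>x. frechet_derivative f (at x) v)" for v
    by (rule Suc.IH) (use Suc.prems in fastforce)
  ultimately show ?case by simp
qed

lemma Ck_on_const [simp]: "Ck_on k S (\<lambda>x. c)"
proof (induction k arbitrary: c)
  case (Suc k)
  show ?case using Suc[of 0] by simp
qed simp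

lemma Ck_on_bounded_linear:
  assumes "open S" "bounded_linear L" "Ck_on k S f"
  shows "Ck_on k S (\<lambda>x. L (f x))"
  using assms(3)
proof (induction k arbitrary: f)
  case 0
  then show ?case
    using bounded_linear.continuous_on[OF assms(2)] by auto
next
  case (Suc k)
  have d: "((\<lambda>x. L (f x)) has_derivative (\<lambda>v. L (frechet_derivative f (at x) v))) (at x)"
    if "x \<in> S" for x
    by (intro bounded_linear.has_derivative[OF assms(2)] frechet_derivative_has_derivative)
      (use Suc.prems that in simp)
  have "Ck_on k S (\<lambda>x. frechet_derivative (\<lambda>x. L (f x)) (at x) v)" for v
  proof (rule Ck_on_cong[OF assms(1)])
    show "Ck_on k S (\<lambda>x. L (frechet_derivative f (at x) v))"
      using Suc by simp
  qed (simp add: frechet_derivative_at[OF d, symmetric])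
  then show ?case using d by (auto intro: differentiableI)
qed

lemma Ck_on_linear:
  fixes L :: "'a::euclidean_space \<Rightarrow> 'b::real_normed_vector"
  assumes "open S" "linear L"
  shows "Ck_on k S L"
proof (cases k)
  case 0
  then show ?thesis
    using assms(2) linear_continuous_on linear_linear linear_conv_bounded_linear by auto
next
  case (Suc m)
  have d: "(L has_derivative L) (at x)" for x
    using assms(2) by (simp add: bounded_linear_imp_has_derivative linear_conv_bounded_linear)
  then show ?thesis
    using Suc by (auto simp: frechet_derivative_at[OF d, symmetric] intro: differentiableI)
qed

lemma Ck_on_add:
  assumes "open S" "Ck_on k S f" "Ck_on k S h"
  shows "Ck_on k S (\<lambda>x. f x + h x)"
  using assms(2,3)
proof (induction k arbitrary: f h)
  case 0
  then show ?case by (auto intro: continuous_on_add)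
next
  case (Suc k)
  have d: "((\<lambda>x. f x + h x) has_derivative
      (\<lambda>v. frechet_derivative f (at x) v + frechet_derivative h (at x) v)) (at x)"
    if "x \<in> S" for x
    using Suc.prems that by (auto intro!: has_derivative_add frechet_derivative_has_derivative)
  have "Ck_on k S (\<lambda>x. frechet_derivative (\<lambda>x. f x + h x) (at x) v)" for v
  proof (rule Ck_on_cong[OF assms(1)])
    show "Ck_on k S (\<lambda>x. frechet_derivative f (at x) v + frechet_derivative h (at x) v)"
      using Suc by simp
  qed (simp add: frechet_derivative_at[OF d, symmetric])
  then show ?case using d by (auto intro: differentiableI)
qed

lemma Ck_on_sum:
  assumes "open S" "\<And>i. i \<in> I \<Longrightarrow> Ck_on k S (f i)"
  shows "Ck_on k S (\<lambda>x. \<Sum>i\<in>I. f i x)"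
  using assms(2)
  by (induction I rule: infinite_finite_induct) (auto intro: Ck_on_add[OF assms(1)])

lemma Ck_on_scaleR:
  assumes "open S" "Ck_on k S f" "Ck_on k S h"
  shows "Ck_on k S (\<lambda>x. f x *\<^sub>R h x)"
  using assms(2,3)
proof (induction k arbitrary: f h)
  case 0
  then show ?case by (auto intro: continuous_on_scaleR)
next
  case (Suc k)
  have d: "((\<lambda>x. f x *\<^sub>R h x) has_derivative
      (\<lambda>v. f x *\<^sub>R frechet_derivative h (at x) v + frechet_derivative f (at x) v *\<^sub>R h x)) (at x)"
    if "x \<in> S" for x
    using Suc.prems that by (auto intro!: has_derivative_scaleR frechet_derivative_has_derivative)
  have "Ck_on k S (\<lambda>x. frechet_derivative (\<lambda>x. f x *\<^sub>R h x) (at x) v)" for v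
  proof (rule Ck_on_cong[OF assms(1)])
    show "Ck_on k S (\<lambda>x. f x *\<^sub>R frechet_derivative h (at x) v
        + frechet_derivative f (at x) v *\<^sub>R h x)"
      \<comment> \<open>The product rule mixes derivatives with the functions themselves, so the
        latter must be lowered from order \<open>Suc k\<close> to \<open>k\<close>.\<close>
      using Suc Ck_on_SucD[of k S f] Ck_on_SucD[of k S h]
      by (intro Ck_on_add[OF assms(1)] Suc.IH) auto
  qed (simp add: frechet_derivative_at[OF d, symmetric])
  then show ?case using d by (auto intro: differentiableI)
qed

lemma Ck_on_compose:
  fixes h :: "'a::euclidean_space \<Rightarrow> 'b::euclidean_space"
  assumes "open S" "h ` S \<subseteq> T" "Ck_on k T f" "Ck_on k S h"
  shows "Ck_on k S (\<lambda>x. f (h x))"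
  using assms(3,4)
proof (induction k arbitrary: f)
  case 0
  then show ?case
    using assms(2) by (auto intro: continuous_on_compose2)
next
  case (Suc k)
  define Df where "Df x = frechet_derivative f (at x)" for x
  define Dh where "Dh x = frechet_derivative h (at x)" for x
  have df: "(f has_derivative Df (h x)) (at (h x))" if "x \<in> S" for x
    unfolding Df_def using Suc.prems(1) assms(2) that
    by (auto intro!: frechet_derivative_has_derivative)
  have dh: "(h has_derivative Dh x) (at x)" if "x \<in> S" for x
    unfolding Dh_def using Suc.prems(2) that by (auto intro!: frechet_derivative_has_derivative)
  have d: "((\<lambda>x. f (h x)) has_derivative (\<lambda>v. Df (h x) (Dh x v))) (at x)" if "x \<in> S" for x
    using diff_chain_at[OF dh[OF that] df[OF that]] by (simp add: o_def)
  have "Ck_on k S (\<lambda>x. frechet_derivative (\<lambda>x. f (h x)) (at x) v)" for v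
  proof (rule Ck_on_cong[OF assms(1)])
    \<comment> \<open>In \<open>Df (h x) (Dh x v)\<close> the direction varies with
      \<open>x\<close>, so the induction hypothesis does not apply as it stands. Expanding the
      direction in \<open>Basis\<close> leaves fixed directions \<open>b\<close>, and each partial
      derivative composed with \<open>h\<close> is covered.\<close>
    show "Ck_on k S (\<lambda>x. \<Sum>b\<in>Basis. (Dh x v \<bullet> b) *\<^sub>R Df (h x) b)"
    proof (intro Ck_on_sum Ck_on_scaleR assms(1))
      show "Ck_on k S (\<lambda>x. Dh x v \<bullet> b)" for b
        unfolding Dh_def
        by (intro Ck_on_bounded_linear[OF assms(1) bounded_linear_inner_left])
          (use Suc.prems(2) in simp)
      show "Ck_on k S (\<lambda>x. Df (h x) b)" for b
        unfolding Df_def using Suc.prems(1)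
        by (intro Suc.IH[of "\<lambda>y. frechet_derivative f (at y) b"] Ck_on_SucD[OF Suc.prems(2)]) simp
    qed
    fix x assume "x \<in> S"
    have "linear (Df (h x))"
      using df[OF \<open>x \<in> S\<close>] has_derivative_linear by blast
    then have "Df (h x) (\<Sum>b\<in>Basis. (Dh x v \<bullet> b) *\<^sub>R b)
        = (\<Sum>b\<in>Basis. (Dh x v \<bullet> b) *\<^sub>R Df (h x) b)"
      by (simp add: linear_sum linear_scale)
    then show "(\<Sum>b\<in>Basis. (Dh x v \<bullet> b) *\<^sub>R Df (h x) b)
        = frechet_derivative (\<lambda>x. f (h x)) (at x) v"
      by (simp add: euclidean_representation frechet_derivative_at[OF d[OF \<open>x \<in> S\<close>], symmetric])
  qed
  then show ?case using d by (auto intro: differentiableI)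
qed

subsection \<open>Bump functions\<close>

text \<open>The polynomial factor makes the family closed under differentiation, so smoothness of
  the classical \<open>exp (-1/t)\<close> follows by one induction over all
  \<open>q\<close>.\<close>

definition flat_fun :: "real poly \<Rightarrow> real \<Rightarrow> real" where
  "flat_fun q t = (if t > 0 then poly q (1 / t) * exp (- (1 / t)) else 0)"

lemma flat_fun_tendsto_0: "(flat_fun q \<longlongrightarrow> 0) (at 0)"
proof -
  have "((\<lambda>x::real. \<Sum>i\<le>degree q. coeff q i * (x ^ i / exp x)) \<longlongrightarrow> (\<Sum>i\<le>degree q. coeff q i * 0)) at_top"
    by (intro tendsto_intros tendsto_power_div_exp_0)
  then have "((\<lambda>x. poly q x / exp x) \<longlongrightarrow> 0) at_top"
    by (simp add: poly_altdef sum_divide_distrib)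
  then have "((\<lambda>t. poly q (inverse t) / exp (inverse t)) \<longlongrightarrow> 0) (at_right 0)"
    by (rule filterlim_compose[OF _ filterlim_inverse_at_top_right])
  then have "(flat_fun q \<longlongrightarrow> 0) (at_right 0)"
    by (rule Lim_transform_eventually)
      (simp add: eventually_at_right_field flat_fun_def exp_minus field_simps exI[of _ 1])
  moreover have "(flat_fun q \<longlongrightarrow> 0) (at_left 0)"
    by (rule tendsto_eventually) (simp add: eventually_at_left_field flat_fun_def exI[of _ "-1"])
  ultimately show ?thesis
    by (simp add: filterlim_at_split)
qed

text \<open>With \<open>s = 1/t\<close> one has \<open>d/dt = - s^2 d/ds\<close>, and
  \<open>q(s) exp(-s)\<close> has \<open>s\<close>-derivative \<open>(q' - q) exp(-s)\<close>. The
  product is \<open>s^2 (q - q') exp(-s)\<close>, and \<open>[:0, 0, 1:]\<close> is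
  \<open>s^2\<close>.\<close>

lemma flat_fun_has_derivative:
  "(flat_fun q has_real_derivative flat_fun ([:0, 0, 1:] * (q - pderiv q)) t) (at t)"
proof (cases t "0::real" rule: linorder_cases)
  case greater
  have "((\<lambda>t. poly q (1 / t) * exp (- (1 / t))) has_real_derivative
      flat_fun ([:0, 0, 1:] * (q - pderiv q)) t) (at t)"
    using greater
    by (auto intro!: derivative_eq_intros DERIV_chain2[OF poly_DERIV]
        simp: flat_fun_def field_simps power2_eq_square)
  then show ?thesis
    by (rule has_field_derivative_transform_within_open[where S = "{0<..}"])
      (use greater in \<open>auto simp: flat_fun_def\<close>)
next
  case less
  have "((\<lambda>t. 0) has_real_derivative flat_fun ([:0, 0, 1:] * (q - pderiv q)) t) (at t)"
    using less by (simp add: flat_fun_def)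
  then show ?thesis
    by (rule has_field_derivative_transform_within_open[where S = "{..<0}"])
      (use less in \<open>auto simp: flat_fun_def\<close>)
next
  case equal
  \<comment> \<open>Dividing by \<open>h\<close> multiplies the polynomial in \<open>1/h\<close> by
    its variable, which is \<open>pCons 0 q\<close>; so the difference quotient is again in the
    family and tends to 0.\<close>
  have "((\<lambda>h. (flat_fun q (0 + h) - flat_fun q 0) / h) \<longlongrightarrow> 0) (at 0)"
  proof (rule Lim_transform_eventually[OF flat_fun_tendsto_0[of "pCons 0 q"]])
    show "\<forall>\<^sub>F h in at 0. flat_fun (pCons 0 q) h = (flat_fun q (0 + h) - flat_fun q 0) / h"
      by (simp add: flat_fun_def eventually_at exI[of _ 1])
  qed
  then show ?thesis
    using equal by (simp add: DERIV_def flat_fun_def)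
qed

lemma Ck_on_flat_fun: "Ck_on k UNIV (flat_fun q)"
proof (induction k arbitrary: q)
  case 0
  then show ?case
    using DERIV_isCont[OF flat_fun_has_derivative] by (simp add: continuous_at_imp_continuous_on)
next
  case (Suc k)
  define q' where "q' = [:0, 0, 1:] * (q - pderiv q)"
  have d: "(flat_fun q has_derivative (\<lambda>v. v *\<^sub>R flat_fun q' t)) (at t)" for t
    using flat_fun_has_derivative[of q t]
    unfolding has_field_derivative_def q'_def by (rule has_derivative_eq_rhs) auto
  have "Ck_on k UNIV (\<lambda>t. v *\<^sub>R flat_fun q' t)" for v
    by (intro Ck_on_scaleR Suc) simp_all
  then show ?case
    using d by (auto simp: frechet_derivative_at[OF d, symmetric] intro: differentiableI)
qed

lemma ex_bump:
  fixes a :: "'a::euclidean_space"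
  assumes "r > 0"
  obtains f :: "'a \<Rightarrow> real"
  where "\<And>k S. open S \<Longrightarrow> Ck_on k S f" "f a = 1" "\<And>x. x \<notin> cball a r \<Longrightarrow> f x = 0"
proof
  define c where "c = exp (- (1 / r\<^sup>2))"
  \<comment> \<open>The squared distance is polynomial in the coordinates, hence smooth at
    \<open>a\<close> too, unlike the norm. The constant \<open>c\<close> is the value of
    \<open>flat_fun 1\<close> at the centre and normalises \<open>f a\<close> to 1.\<close>
  define f where "f x = (1 / c) *\<^sub>R flat_fun 1 (r\<^sup>2 - (x - a) \<bullet> (x - a))" for x
  have [simp]: "c \<noteq> 0" by (simp add: c_def)
  show "Ck_on k S f" if "open S" for k S
  proof -
    have lin: "Ck_on k S (\<lambda>x. (x - a) \<bullet> b)" for b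
      using Ck_on_add[OF that Ck_on_linear[OF that] Ck_on_const, of "\<lambda>x. x \<bullet> b" k "- (a \<bullet> b)"]
      by (simp add: inner_diff_left linear_iff inner_add_left)
    have "Ck_on k S (\<lambda>x. r\<^sup>2 + (-1) *\<^sub>R (\<Sum>b\<in>Basis. ((x - a) \<bullet> b) *\<^sub>R ((x - a) \<bullet> b)))"
      by (intro Ck_on_add Ck_on_scaleR Ck_on_sum Ck_on_const lin that)
    also have "(\<lambda>x. r\<^sup>2 + (-1) *\<^sub>R (\<Sum>b\<in>Basis. ((x - a) \<bullet> b) *\<^sub>R ((x - a) \<bullet> b)))
        = (\<lambda>x. r\<^sup>2 - (x - a) \<bullet> (x - a))"
      by (subst euclidean_inner[of "_ - a"]) simp
    finally show ?thesis
      unfolding f_def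
      by (intro Ck_on_scaleR Ck_on_const that Ck_on_compose[OF that _ Ck_on_flat_fun]) auto
  qed
  show "f a = 1"
    using assms by (simp add: f_def flat_fun_def c_def)
  show "f x = 0" if "x \<notin> cball a r" for x
  proof -
    have "r\<^sup>2 < (norm (x - a))\<^sup>2"
      using that assms by (intro power_strict_mono) (auto simp: dist_norm norm_minus_commute)
    then show ?thesis
      by (simp add: f_def flat_fun_def power2_norm_eq_inner)
  qed
qed

subsection \<open>Orthonormal bases\<close>

text \<open>Gram-Schmidt with respect to \<open>G\<close>, started at the prescribed unit vector
  \<open>u\<close>, which will be \<open>\<xi> p\<close>.\<close>

lemma ex_orthonormal_basis:
  fixes G :: "'e::euclidean_space \<Rightarrow> 'e \<Rightarrow> real"
  assumes G: "bilinear G" "\<And>u v. G u v = G v u" "\<And>v. v \<noteq> 0 \<Longrightarrow> G v v > 0"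
    and dim: "DIM('e) = Suc N" and u: "G u u = 1"
  obtains e :: "nat \<Rightarrow> 'e" where "e 0 = u"
    and "\<And>i j. i \<le> N \<Longrightarrow> j \<le> N \<Longrightarrow> G (e i) (e j) = (if i = j then 1 else 0)"
    and "span (e ` {..N}) = UNIV"
proof -
  have "\<exists>e. e 0 = u \<and> (\<forall>i\<le>k. \<forall>j\<le>k. G (e i) (e j) = (if i = j then 1 else 0))"
    if "k \<le> N" for k
    using that
  proof (induction k)
    case 0
    then show ?case using u by (intro exI[of _ "\<lambda>_. u"]) simp
  next
    case (Suc k)
    then obtain e where e: "e 0 = u"
      "\<And>i j. i \<le> k \<Longrightarrow> j \<le> k \<Longrightarrow> G (e i) (e j) = (if i = j then 1 else 0)"
      by auto
    have "dim (span (e ` {..k})) \<le> card (e ` {..k})"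
      by (intro dim_le_card) auto
    also have "\<dots> \<le> Suc k"
      using card_image_le[of "{..k}" e] by simp
    also have "\<dots> < DIM('e)"
      using Suc.prems dim by simp
    finally have "span (e ` {..k}) \<noteq> UNIV"
      by (metis dim_UNIV less_irrefl)
    then obtain v where v: "v \<notin> span (e ` {..k})"
      by blast
    define w where "w = v - (\<Sum>i\<le>k. G v (e i) *\<^sub>R e i)"
    have "w \<noteq> 0"
    proof
      assume "w = 0"
      then have "v = (\<Sum>i\<le>k. G v (e i) *\<^sub>R e i)" by (simp add: w_def)
      also have "\<dots> \<in> span (e ` {..k})"
        by (intro span_sum span_scale span_base) auto
      finally show False using v by blast
    qed
    then have pos: "G w w > 0" by (rule G(3))
    have orth: "G w (e j) = 0" if "j \<le> k" for j
    proof -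
      have "linear (\<lambda>v. G v (e j))" using G(1) by (simp add: bilinear_def)
      then have "G w (e j) = G v (e j) - (\<Sum>i\<le>k. G v (e i) * G (e i) (e j))"
        unfolding w_def by (subst linear_diff, assumption, subst linear_sum, assumption)
          (simp add: bilinear_lmul[OF G(1)])
      also have "(\<Sum>i\<le>k. G v (e i) * G (e i) (e j)) = (\<Sum>i\<le>k. if i = j then G v (e j) else 0)"
        by (rule sum.cong) (use e(2) that in auto)
      finally show ?thesis using that by simp
    qed
    define e' where "e' = e(Suc k := (1 / sqrt (G w w)) *\<^sub>R w)"
    have "G (e' i) (e' j) = (if i = j then 1 else 0)" if "i \<le> Suc k" "j \<le> Suc k" for i j
      using that e(2) orth pos orth[unfolded G(2)[of w]]
      by (auto simp: e'_def bilinear_lmul[OF G(1)] bilinear_rmul[OF G(1)] le_Suc_eq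
          real_sqrt_mult_self)
    then show ?case using e(1) by (intro exI[of _ e']) (simp add: e'_def)
  qed
  from this[OF order_refl] obtain e where e: "e 0 = u"
    "\<And>i j. i \<le> N \<Longrightarrow> j \<le> N \<Longrightarrow> G (e i) (e j) = (if i = j then 1 else 0)"
    by auto
  have inj: "inj_on e {..N}"
    by (rule inj_onI) (metis atMost_iff e(2) zero_neq_one)
  \<comment> \<open>A vector in the span of the others would be \<open>G\<close>-orthogonal to
    itself, against \<open>G (e i) (e i) = 1\<close>. The \<open>N + 1\<close> independent vectors
    then fill the space by dimension.\<close>
  have "independent (e ` {..N})"
  proof
    assume "dependent (e ` {..N})"
    then obtain i where i: "i \<le> N" "e i \<in> span (e ` {..N} - {e i})"
      by (auto simp: dependent_def)
    have "G (e i) x = 0" if "x \<in> span (e ` {..N} - {e i})" for x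
      using that
    proof (induction rule: span_induct)
      case base
      show ?case using G(1)
        by (simp add: subspace_def bilinear_radd bilinear_rmul bilinear_rzero)
    next
      case (step x)
      then show ?case using e(2) i(1) by auto
    qed
    then show False using i e(2) by fastforce
  qed
  then have "span (e ` {..N}) = UNIV"
    using card_ge_dim_independent[of "e ` {..N}" UNIV] dim card_image[OF inj] by auto
  with e show thesis by (rule that)
qed

subsection \<open>Vector fields\<close>

lemma smooth_atlas_chart:
  assumes "smooth_atlas A" "K \<in> A"
  shows "open (fst K)" "open (chart_image K)"
    "homeomorphism (fst K) (chart_image K) (snd K) (chart_inv K)"
  using assms by (auto simp: smooth_atlas_def is_chart_def)

lemma chart_at:
  assumes "smooth_atlas A"
  shows "chart_at A p \<in> A" "p \<in> fst (chart_at A p)"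
proof -
  have "\<exists>K. K \<in> A \<and> p \<in> fst K"
    using assms unfolding smooth_atlas_def by blast
  then have "chart_at A p \<in> A \<and> p \<in> fst (chart_at A p)"
    unfolding chart_at_def by (rule someI_ex)
  then show "chart_at A p \<in> A" "p \<in> fst (chart_at A p)" by auto
qed

lemma chart_inv_chart:
  assumes "smooth_atlas A" "K \<in> A" "q \<in> fst K"
  shows "chart_inv K (snd K q) = q" "snd K q \<in> chart_image K"
  using smooth_atlas_chart(3)[OF assms(1,2)] assms(3)
  by (auto simp: homeomorphism_def chart_image_def)

lemma chart_chart_inv:
  assumes "smooth_atlas A" "K \<in> A" "y \<in> chart_image K"
  shows "snd K (chart_inv K y) = y" "chart_inv K y \<in> fst K"
  using smooth_atlas_chart(3)[OF assms(1,2)] assms(3)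
  by (auto simp: homeomorphism_def chart_image_def)

lemma open_chart_image_Int:
  assumes "smooth_atlas A" "K \<in> A" "open U"
  shows "open (snd K ` (fst K \<inter> U))"
proof -
  have "openin (top_of_set (fst K)) (fst K \<inter> U)"
    using assms(3) by blast
  then have "openin (top_of_set (chart_image K)) (snd K ` (fst K \<inter> U))"
    using homeomorphism_imp_open_map[OF smooth_atlas_chart(3)[OF assms(1,2)]] by blast
  then show ?thesis
    using smooth_atlas_chart(2)[OF assms(1,2)] openin_open_trans by blast
qed

lemma Ck_on_transition:
  assumes "smooth_atlas A" "K \<in> A" "L \<in> A"
  shows "Ck_on k (snd K ` (fst K \<inter> fst L)) (snd L \<circ> chart_inv K)"
  using assms unfolding smooth_atlas_def smooth_on_def by blast

lemma transition_has_derivative: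
  assumes "smooth_atlas A" "K \<in> A" "L \<in> A" "q \<in> fst K" "q \<in> fst L"
  shows "((snd L \<circ> chart_inv K) has_derivative
    frechet_derivative (snd L \<circ> chart_inv K) (at (snd K q))) (at (snd K q))"
  using Ck_on_transition[OF assms(1-3), of "Suc 0"] assms(4,5)
  by (intro frechet_derivative_has_derivative) auto

lemma linear_comps:
  assumes "smooth_atlas A" "K \<in> A" "q \<in> fst K"
  shows "linear (comps A K q)"
proof -
  note transition_has_derivative[OF assms(1) chart_at(1)[OF assms(1)] assms(2)
      chart_at(2)[OF assms(1)] assms(3)]
  from has_derivative_linear[OF this] show ?thesis
    by (simp add: comps_def[abs_def] coord_at_def)
qed

text \<open>Chain rule through the storage chart: near \<open>snd L q\<close>, going from
  \<open>L\<close> to \<open>chart_at A q\<close> and on to \<open>K\<close> is the direct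
  transition from \<open>L\<close> to \<open>K\<close>. The possibly jumping chart thus drops
  out.\<close>

lemma comps_transition:
  assumes "smooth_atlas A" "K \<in> A" "L \<in> A" "q \<in> fst K" "q \<in> fst L"
  shows "comps A K q (frechet_derivative (snd (chart_at A q) \<circ> chart_inv L) (at (snd L q)) v)
    = frechet_derivative (snd K \<circ> chart_inv L) (at (snd L q)) v"
proof -
  define N where "N = chart_at A q"
  have N: "N \<in> A" "q \<in> fst N"
    using chart_at[OF assms(1)] by (auto simp: N_def)
  have "((snd K \<circ> chart_inv N) has_derivative comps A K q) (at (snd N q))"
    using transition_has_derivative[OF assms(1) N(1) assms(2) N(2) assms(4)]
    by (simp add: comps_def[abs_def] N_def coord_at_def)
  moreover have "(snd N \<circ> chart_inv L) (snd L q) = snd N q"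
    using chart_inv_chart[OF assms(1,3,5)] by simp
  ultimately have "((snd K \<circ> chart_inv N) \<circ> (snd N \<circ> chart_inv L) has_derivative
      comps A K q \<circ> frechet_derivative (snd N \<circ> chart_inv L) (at (snd L q))) (at (snd L q))"
    using transition_has_derivative[OF assms(1,3) N(1) assms(5) N(2)]
    by (intro diff_chain_at) auto
  then have "(snd K \<circ> chart_inv L has_derivative
      comps A K q \<circ> frechet_derivative (snd N \<circ> chart_inv L) (at (snd L q))) (at (snd L q))"
  proof (rule has_derivative_transform_within_open)
    show "open (snd L ` (fst L \<inter> fst N))"
      using open_chart_image_Int[OF assms(1,3)] smooth_atlas_chart(1)[OF assms(1) N(1)] by blast
    show "snd L q \<in> snd L ` (fst L \<inter> fst N)" using assms(5) N by blast
  qed (auto simp: chart_inv_chart[OF assms(1,3)] chart_inv_chart[OF assms(1) N(1)])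
  from frechet_derivative_at[OF this] show ?thesis
    by (simp add: N_def o_def fun_eq_iff)
qed

lemma smooth_fun_const: "smooth_fun A (\<lambda>q. c)"
  by (simp add: smooth_fun_def smooth_on_def o_def)

lemma vector_field_add:
  assumes "smooth_atlas A" "vector_field A X" "vector_field A Y"
  shows "vector_field A (\<lambda>q. X q + Y q)"
  unfolding vector_field_def smooth_on_def
proof (intro ballI allI)
  fix K k assume K: "K \<in> A"
  note S = smooth_atlas_chart(2)[OF assms(1) K]
  show "Ck_on k (chart_image K) (field_comps A K (\<lambda>q. X q + Y q))"
  proof (rule Ck_on_cong[OF S])
    show "Ck_on k (chart_image K) (\<lambda>y. field_comps A K X y + field_comps A K Y y)"
      using assms(2,3) K S unfolding vector_field_def smooth_on_def by (intro Ck_on_add) auto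
  qed (simp add: field_comps_def chart_chart_inv[OF assms(1) K]
      linear_add[OF linear_comps[OF assms(1) K]])
qed

lemma vector_field_scaleR:
  assumes "smooth_atlas A" "smooth_fun A f" "vector_field A X"
  shows "vector_field A (\<lambda>q. f q *\<^sub>R X q)"
  unfolding vector_field_def smooth_on_def
proof (intro ballI allI)
  fix K k assume K: "K \<in> A"
  note S = smooth_atlas_chart(2)[OF assms(1) K]
  show "Ck_on k (chart_image K) (field_comps A K (\<lambda>q. f q *\<^sub>R X q))"
  proof (rule Ck_on_cong[OF S])
    show "Ck_on k (chart_image K) (\<lambda>y. f (chart_inv K y) *\<^sub>R field_comps A K X y)"
      using assms(2,3) K S unfolding vector_field_def smooth_fun_def smooth_on_def o_def
      by (intro Ck_on_scaleR) auto
  qed (simp add: field_comps_def chart_chart_inv[OF assms(1) K]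
      linear_scale[OF linear_comps[OF assms(1) K]])
qed

text \<open>The field with constant components \<open>v\<close> in a chart \<open>L\<close> around
  \<open>p\<close> is cut off by a bump function and extended by zero.\<close>

lemma ex_vector_field:
  fixes A :: "('m::{t2_space, second_countable_topology}, 'e::euclidean_space) chart set"
  assumes A: "smooth_atlas A"
  obtains X where "vector_field A X" "X p = v"
proof -
  define L where "L = chart_at A p"
  have L: "L \<in> A" "p \<in> fst L"
    using chart_at[OF A] by (auto simp: L_def)
  note inv_L = chart_inv_chart[OF A L(1)] and L_inv = chart_chart_inv[OF A L(1)]
  obtain r where r: "r > 0" "cball (snd L p) r \<subseteq> chart_image L"
    using smooth_atlas_chart(2)[OF A L(1)] inv_L(2)[OF L(2)]
    by (meson open_contains_cball_eq)
  obtain f :: "'e \<Rightarrow> real" where f: "\<And>k S. open S \<Longrightarrow> Ck_on k S f" "f (snd L p) = 1"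
    "\<And>x. x \<notin> cball (snd L p) r \<Longrightarrow> f x = 0"
    by (rule ex_bump[OF r(1), of "snd L p"]) (rule that)
  \<comment> \<open>\<open>C\<close> contains the support of the cut-off field. Being compact in a
    Hausdorff space it is closed, so the region where the field is zero includes an open set
    reaching up to and beyond the edge of \<open>fst L\<close>.\<close>
  define C where "C = chart_inv L ` cball (snd L p) r"
  have "compact C"
    unfolding C_def
  proof (rule compact_continuous_image)
    show "continuous_on (cball (snd L p) r) (chart_inv L)"
      using homeomorphism_cont2[OF smooth_atlas_chart(3)[OF A L(1)]] r(2)
      by (rule continuous_on_subset)
  qed simp
  then have "open (- C)"
    by (simp add: compact_imp_closed open_Compl)
  define d where "d K q = frechet_derivative (snd K \<circ> chart_inv L) (at (snd L q)) v"
    for K :: "('m, 'e) chart" and q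
  define X where
    "X q = (if q \<in> fst L then f (snd L q) *\<^sub>R d (chart_at A q) q else 0)" for q
  have "vector_field A X"
    unfolding vector_field_def smooth_on_def
  proof (intro ballI allI)
    fix K k assume K: "K \<in> A"
    note inv_K = chart_inv_chart[OF A K] and K_inv = chart_chart_inv[OF A K]
    define U where "U = snd K ` (fst K \<inter> fst L)"
    define V where "V = snd L ` (fst L \<inter> fst K)"
    have "open U" "open V"
      unfolding U_def V_def
      using open_chart_image_Int[OF A] smooth_atlas_chart(1)[OF A] K L(1) by auto
    have on_U: "Ck_on k U (field_comps A K X)"
    proof (rule Ck_on_cong[OF \<open>open U\<close>])
      let ?\<tau> = "snd L \<circ> chart_inv K"
      have \<tau>: "Ck_on k U ?\<tau>"
        unfolding U_def by (rule Ck_on_transition[OF A K L(1)])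
      have dV: "Ck_on k V (\<lambda>z. frechet_derivative (snd K \<circ> chart_inv L) (at z) v)"
        \<comment> \<open>The components are derivatives of a transition map, so one order more is
          asked of that map.\<close>
        using Ck_on_transition[OF A L(1) K, of "Suc k"] by (simp add: V_def)
      have "?\<tau> ` U \<subseteq> V"
        by (auto simp: U_def V_def inv_K)
      then show "Ck_on k U (\<lambda>y. f (?\<tau> y) *\<^sub>R frechet_derivative (snd K \<circ> chart_inv L) (at (?\<tau> y)) v)"
        by (intro Ck_on_scaleR[OF \<open>open U\<close>] Ck_on_compose[OF \<open>open U\<close> _ f(1)[OF \<open>open V\<close>] \<tau>]
            Ck_on_compose[OF \<open>open U\<close> _ dV \<tau>])
      fix y assume "y \<in> U"
      then obtain q where q: "q \<in> fst K" "q \<in> fst L" "y = snd K q" by (auto simp: U_def)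
      then show "f (?\<tau> y) *\<^sub>R frechet_derivative (snd K \<circ> chart_inv L) (at (?\<tau> y)) v
          = field_comps A K X y"
        by (simp add: inv_K field_comps_def X_def linear_scale[OF linear_comps[OF A K]] d_def
            comps_transition[OF A K L(1)])
    qed
    define W where "W = snd K ` (fst K \<inter> - C)"
    have "open W"
      unfolding W_def by (rule open_chart_image_Int[OF A K \<open>open (- C)\<close>])
    have on_W: "Ck_on k W (field_comps A K X)"
    proof (rule Ck_on_cong[OF \<open>open W\<close> _ Ck_on_const[of k W 0]])
      fix y assume "y \<in> W"
      then obtain q where q: "q \<in> fst K" "q \<notin> C" "y = snd K q" by (auto simp: W_def)
      have "f (snd L q) = 0" if "q \<in> fst L"
        using f(3) inv_L(1)[OF that] q(2) unfolding C_def by (metis imageI)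
      then have "X q = 0" by (simp add: X_def)
      then show "0 = field_comps A K X y"
        using q by (simp add: field_comps_def inv_K linear_0[OF linear_comps[OF A K]])
    qed
    have "C \<subseteq> fst L"
      using r(2) L_inv(2) by (auto simp: C_def)
    \<comment> \<open>Points of \<open>K\<close> outside \<open>fst L\<close> lie outside
      \<open>C\<close>, so the two open regions cover the chart.\<close>
    then have "chart_image K \<subseteq> U \<union> W"
      by (auto simp: chart_image_def U_def W_def)
    then show "Ck_on k (chart_image K) (field_comps A K X)"
      using on_U on_W \<open>open U\<close> \<open>open W\<close> by (intro Ck_on_local) blast
  qed
  moreover have "X p = v"
  proof -
    have "((snd L \<circ> chart_inv L) has_derivative (\<lambda>v. v)) (at (snd L p))"
      by (rule has_derivative_transform_within_open[OF has_derivative_ident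
          smooth_atlas_chart(2)[OF A L(1)]]) (simp_all add: L_inv inv_L(2)[OF L(2)])
    from frechet_derivative_at[OF this] have "d L p = v"
      by (simp add: d_def fun_eq_iff)
    then show ?thesis
      using L(2) f(2) by (simp add: X_def flip: L_def)
  qed
  ultimately show thesis by (rule that)
qed

subsection \<open>Traces in an orthonormal basis\<close>

context
  fixes n :: nat and g :: "'m \<Rightarrow> 'e::euclidean_space \<Rightarrow> 'e \<Rightarrow> real" and \<xi> :: "'m \<Rightarrow> 'e"
    and p :: 'm and e :: "nat \<Rightarrow> 'e"
  assumes bil: "bilinear (g p)" and onb: "orthonormal_basis_at n g \<xi> p e"
begin

text \<open>Both sides are linear in \<open>u\<close>, so it is enough to compare them on the
  spanning vectors \<open>e j\<close>.\<close>

lemma orthonormal_expansion: "(\<Sum>i\<le>2 * n. g p u (e i) *\<^sub>R e i) = u"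
proof -
  have e: "g p (e i) (e j) = (if i = j then 1 else 0)" if "i \<le> 2 * n" "j \<le> 2 * n" for i j
    using onb that by (simp add: orthonormal_basis_at_def)
  have "u \<in> span (e ` {..2 * n})"
    using onb by (simp add: orthonormal_basis_at_def)
  then show ?thesis
  proof (induction rule: span_induct)
    case base
    show ?case
      by (auto simp: subspace_def bilinear_lzero[OF bil] bilinear_ladd[OF bil] bilinear_lmul[OF bil]
          scaleR_add_left sum.distrib simp flip: scaleR_scaleR scaleR_sum_right)
  next
    case (step u)
    then obtain j where j: "j \<le> 2 * n" "u = e j" by auto
    have "(\<Sum>i\<le>2 * n. g p u (e i) *\<^sub>R e i) = (\<Sum>i\<le>2 * n. if i = j then e j else 0)"
      by (rule sum.cong) (use e j in auto)
    then show ?case using j by simp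
  qed
qed

lemma orthonormal_parseval: "(\<Sum>i\<le>2 * n. g p u (e i) * g p v (e i)) = g p v u"
proof -
  have lin: "linear (g p v)" using bil by (simp add: bilinear_def)
  have "g p v u = g p v (\<Sum>i\<le>2 * n. g p u (e i) *\<^sub>R e i)"
    by (simp add: orthonormal_expansion)
  then show ?thesis
    by (simp add: linear_sum[OF lin] bilinear_rmul[OF bil])
qed

text \<open>\<open>endo_trace\<close> uses the Euclidean \<open>Basis\<close>, which need not be
  \<open>g\<close>-orthonormal. Expanding \<open>f b\<close> in \<open>e\<close>, swapping the sums
  and reassembling \<open>e i\<close> from its Euclidean coordinates changes the basis, which makes
  \<open>tr \<phi> = 0\<close> usable.\<close>

lemma orthonormal_trace:
  assumes "linear f"
  shows "(\<Sum>i\<le>2 * n. g p (f (e i)) (e i)) = endo_trace f"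
proof -
  have lin: "linear (\<lambda>v. g p (f v) w)" for w
    using bil linear_compose[OF assms, of "\<lambda>v. g p v w"] by (simp add: bilinear_def o_def)
  have "endo_trace f = (\<Sum>b\<in>Basis. (\<Sum>i\<le>2 * n. g p (f b) (e i) *\<^sub>R e i) \<bullet> b)"
    by (simp add: endo_trace_def orthonormal_expansion)
  also have "\<dots> = (\<Sum>b\<in>Basis. \<Sum>i\<le>2 * n. g p (f b) (e i) * (e i \<bullet> b))"
    by (simp add: inner_sum_left)
  also have "\<dots> = (\<Sum>i\<le>2 * n. \<Sum>b\<in>Basis. g p (f b) (e i) * (e i \<bullet> b))"
    by (rule sum.swap)
  also have "\<dots> = (\<Sum>i\<le>2 * n. g p (f (\<Sum>b\<in>Basis. (e i \<bullet> b) *\<^sub>R b)) (e i))"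
    by (simp add: linear_sum[OF lin] linear_scale[OF lin] linear_scale[OF assms]
        bilinear_lmul[OF bil] mult.commute)
  finally show ?thesis by (simp add: euclidean_representation)
qed

end

subsection \<open>Para-Sasaki-like manifolds\<close>

lemma dir_deriv_const: "dir_deriv A X (\<lambda>q. c) p = 0"
  by (simp add: dir_deriv_def o_def)

locale para_Sasaki_like_manifold =
  fixes n :: nat
    and A :: "('m::{t2_space, second_countable_topology}, 'e::euclidean_space) chart set"
    and \<phi> :: "'m \<Rightarrow> 'e \<Rightarrow> 'e" and \<xi> :: "'m \<Rightarrow> 'e" and \<eta> :: "'m \<Rightarrow> 'e \<Rightarrow> real"
    and g :: "'m \<Rightarrow> 'e \<Rightarrow> 'e \<Rightarrow> real"
    and D :: "('m, 'e) connection"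
  assumes apapR: "apapR_manifold n A \<phi> \<xi> \<eta> g"
    and levi_civita: "levi_civita A g D"
    and para_Sasaki_like: "para_Sasaki_like A \<phi> \<xi> \<eta> g D"
begin

section \<open>Pointwise algebra of the structure tensors\<close>

lemma atlas: "smooth_atlas A"
  and dim: "DIM('e) = 2 * n + 1"
  and vector_field_xi: "vector_field A \<xi>"
  and eta_xi: "\<eta> p (\<xi> p) = 1"
  and phi_phi: "\<phi> p (\<phi> p v) = v - \<eta> p v *\<^sub>R \<xi> p"
  and phi_xi: "\<phi> p (\<xi> p) = 0"
  and g_phi_phi: "g p (\<phi> p u) (\<phi> p v) = g p u v - \<eta> p u * \<eta> p v"
  and trace_phi: "endo_trace (\<phi> p) = 0"
  and linear_phi: "linear (\<phi> p)"
  and linear_eta: "linear (\<eta> p)"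
  and bilinear_g: "bilinear (g p)"
  and g_sym: "g p u v = g p v u"
  and g_pos: "v \<noteq> 0 \<Longrightarrow> g p v v > 0"
  using apapR
  by (auto simp: apapR_manifold_def endo_field_def one_form_def riemannian_metric_def)

lemma vector_field_phi: "vector_field A X \<Longrightarrow> vector_field A (\<lambda>q. \<phi> q (X q))"
  and smooth_fun_eta: "vector_field A X \<Longrightarrow> smooth_fun A (\<lambda>q. \<eta> q (X q))"
  and smooth_fun_g:
    "vector_field A X \<Longrightarrow> vector_field A Y \<Longrightarrow> smooth_fun A (\<lambda>q. g q (X q) (Y q))"
  using apapR
  by (auto simp: apapR_manifold_def endo_field_def one_form_def riemannian_metric_def)

lemmas tensor_simps =
  linear_add[OF linear_phi] linear_diff[OF linear_phi] linear_scale[OF linear_phi]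
  linear_neg[OF linear_phi]
  linear_add[OF linear_eta] linear_diff[OF linear_eta] linear_scale[OF linear_eta]
  linear_neg[OF linear_eta]
  bilinear_ladd[OF bilinear_g] bilinear_radd[OF bilinear_g]
  bilinear_lsub[OF bilinear_g] bilinear_rsub[OF bilinear_g]
  bilinear_lmul[OF bilinear_g] bilinear_rmul[OF bilinear_g]
  bilinear_lneg[OF bilinear_g] bilinear_rneg[OF bilinear_g]

lemma g_xi: "g p v (\<xi> p) = \<eta> p v" "g p (\<xi> p) v = \<eta> p v"
proof -
  show "g p v (\<xi> p) = \<eta> p v"
    using g_phi_phi[of p v "\<xi> p"] by (simp add: phi_xi eta_xi bilinear_rzero[OF bilinear_g])
  then show "g p (\<xi> p) v = \<eta> p v" by (simp add: g_sym[of p "\<xi> p"])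
qed

text \<open>Compute the third power of \<open>\<phi>\<close> at \<open>v\<close> in two ways:
  squaring the inner pair gives \<open>\<phi> v\<close>, squaring the outer pair gives
  \<open>\<phi> v - \<eta>(\<phi> v) \<xi>\<close>.\<close>

lemma eta_phi: "\<eta> p (\<phi> p v) = 0"
proof -
  have "\<phi> p (\<phi> p (\<phi> p v)) = \<phi> p v"
    by (simp add: phi_phi[of p v] tensor_simps phi_xi)
  then have "\<eta> p (\<phi> p v) *\<^sub>R \<xi> p = 0"
    by (simp add: phi_phi[of p "\<phi> p v"])
  then have "\<eta> p (\<eta> p (\<phi> p v) *\<^sub>R \<xi> p) = \<eta> p 0"
    by (rule arg_cong)
  then show ?thesis by (simp add: tensor_simps eta_xi linear_0[OF linear_eta] del: scaleR_eq_0_iff)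
qed

lemma g_phi_sym: "g p u (\<phi> p v) = g p (\<phi> p u) v"
  using g_phi_phi[of p "\<phi> p u" v] by (simp add: phi_phi eta_phi tensor_simps g_xi)

lemma g_phi_swap: "g p (\<phi> p u) v = g p (\<phi> p v) u"
  using g_phi_sym[of p v u] g_sym[of p v "\<phi> p u"] by simp

section \<open>Covariant derivatives of the structure tensors\<close>

lemma connection_add:
  "vector_field A X \<Longrightarrow> vector_field A Y \<Longrightarrow> vector_field A Z \<Longrightarrow>
    D X (\<lambda>q. Y q + Z q) p = D X Y p + D X Z p"
  and connection_leibniz:
  "smooth_fun A f \<Longrightarrow> vector_field A X \<Longrightarrow> vector_field A Y \<Longrightarrow>
    D X (\<lambda>q. f q *\<^sub>R Y q) p = dir_deriv A X f p *\<^sub>R Y p + f p *\<^sub>R D X Y p"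
  and vector_field_connection:
  "vector_field A X \<Longrightarrow> vector_field A Y \<Longrightarrow> vector_field A (D X Y)"
  and lie_bracket_eq:
  "vector_field A X \<Longrightarrow> vector_field A Y \<Longrightarrow> lie_bracket A X Y p = D X Y p - D Y X p"
  and dir_deriv_g:
  "vector_field A X \<Longrightarrow> vector_field A Y \<Longrightarrow> vector_field A Z \<Longrightarrow>
    dir_deriv A X (\<lambda>q. g q (Y q) (Z q)) p = g p (D X Y p) (Z p) + g p (Y p) (D X Z p)"
  using levi_civita
  by (simp_all add: levi_civita_def affine_connection_def torsion_free_def metric_connection_def)

lemma connection_scaleR_const:
  "vector_field A X \<Longrightarrow> vector_field A Y \<Longrightarrow> D X (\<lambda>q. c *\<^sub>R Y q) p = c *\<^sub>R D X Y p"
  by (simp add: connection_leibniz smooth_fun_const dir_deriv_const)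

lemma vector_field_scaleR_const: "vector_field A Y \<Longrightarrow> vector_field A (\<lambda>q. c *\<^sub>R Y q)"
  by (rule vector_field_scaleR[OF atlas smooth_fun_const])

text \<open>The structure tensor identity applied to \<open>\<phi> \<xi> = 0\<close> gives \<open>\<phi> (D\<^sub>X \<xi>) = \<phi>\<^sup>2 X\<close>, and
  \<open>D\<^sub>X \<xi>\<close> is orthogonal to \<open>\<xi>\<close> because \<open>\<xi>\<close> has constant length.\<close>

lemma connection_xi:
  assumes X: "vector_field A X"
  shows "D X \<xi> p = \<phi> p (X p)"
proof -
  have "D X (\<lambda>q. \<phi> q (\<xi> q)) p = 0"
    using connection_scaleR_const[OF X vector_field_xi, of 0 p] by (simp add: phi_xi)
  moreover have "D X (\<lambda>q. \<phi> q (\<xi> q)) p - \<phi> p (D X \<xi> p)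
      = - g p (X p) (\<xi> p) *\<^sub>R \<xi> p - \<eta> p (\<xi> p) *\<^sub>R X p
        + (2 * \<eta> p (X p) * \<eta> p (\<xi> p)) *\<^sub>R \<xi> p"
    using para_Sasaki_like X vector_field_xi unfolding para_Sasaki_like_def by blast
  moreover have double: "(2 * a) *\<^sub>R v = a *\<^sub>R v + a *\<^sub>R v" for a and v :: 'e
    by (metis mult_2 scaleR_add_left)
  ultimately have "- \<phi> p (D X \<xi> p) = - (X p - \<eta> p (X p) *\<^sub>R \<xi> p)"
    by (simp add: g_xi eta_xi double)
  then have "\<phi> p (D X \<xi> p) = X p - \<eta> p (X p) *\<^sub>R \<xi> p"
    by (simp only: neg_equal_iff_equal)
  then have "\<phi> p (\<phi> p (D X \<xi> p)) = \<phi> p (X p)"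
    by (simp add: tensor_simps phi_xi)
  moreover have "\<eta> p (D X \<xi> p) = 0"
    using dir_deriv_g[OF X vector_field_xi vector_field_xi, of p]
    by (simp add: g_xi eta_xi dir_deriv_const)
  ultimately show ?thesis by (simp add: phi_phi)
qed

text \<open>Metric compatibility applied to \<open>\<eta>(Z) = g(Z, \<xi>)\<close>, where
  differentiating \<open>\<xi>\<close> contributes \<open>\<phi> X\<close>.\<close>

lemma dir_deriv_eta:
  assumes "vector_field A X" "vector_field A Z"
  shows "dir_deriv A X (\<lambda>q. \<eta> q (Z q)) p = \<eta> p (D X Z p) + g p (\<phi> p (X p)) (Z p)"
  using dir_deriv_g[OF assms vector_field_xi, of p]
  by (simp add: g_xi connection_xi[OF assms(1)] g_sym[of p "Z p" "\<phi> p (X p)"])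

text \<open>With \<open>P = \<alpha> id + \<beta> \<phi>\<close>, the difference of the two connections at \<open>q\<close> is
  \<open>S q u v = g(P u, v) \<xi> - \<eta>(v) P u\<close>; \<open>N\<close> and \<open>DS\<close> are the covariant derivatives of \<open>\<phi>\<close> and \<open>S\<close>.\<close>

context
  fixes \<alpha> \<beta> :: real
begin

definition P :: "'m \<Rightarrow> 'e \<Rightarrow> 'e" where
  "P q v = \<alpha> *\<^sub>R v + \<beta> *\<^sub>R \<phi> q v"

definition S :: "'m \<Rightarrow> 'e \<Rightarrow> 'e \<Rightarrow> 'e" where
  "S q u v = g q (P q u) v *\<^sub>R \<xi> q + \<eta> q v *\<^sub>R (-1 *\<^sub>R P q u)"

definition N :: "'m \<Rightarrow> 'e \<Rightarrow> 'e \<Rightarrow> 'e" where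
  "N q u v = - g q u v *\<^sub>R \<xi> q - \<eta> q v *\<^sub>R u + (2 * \<eta> q u * \<eta> q v) *\<^sub>R \<xi> q"

abbreviation D' :: "('m, 'e) connection" where
  "D' \<equiv> gen_sym_metric_connection \<phi> \<xi> \<eta> g D \<alpha> \<beta>"

text \<open>An equality of fields rather than of values at a point, because \<open>D' Y Z\<close> is
  differentiated again in the curvature.\<close>

lemma D'_eq: "D' X Y = (\<lambda>q. D X Y q + S q (X q) (Y q))"
  by (rule ext)
    (simp add: gen_sym_metric_connection_def S_def P_def tensor_simps algebra_simps)

lemma S_linear:
  "S q (u + v) w = S q u w + S q v w" "S q (u - v) w = S q u w - S q v w"
  "S q u (v + w) = S q u v + S q u w"
  by (simp_all add: S_def P_def tensor_simps algebra_simps)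

lemma vector_field_P: "vector_field A X \<Longrightarrow> vector_field A (\<lambda>q. P q (X q))"
  unfolding P_def by (intro vector_field_add atlas vector_field_scaleR_const vector_field_phi)

lemma vector_field_S:
  "vector_field A X \<Longrightarrow> vector_field A Y \<Longrightarrow> vector_field A (\<lambda>q. S q (X q) (Y q))"
  unfolding S_def
  by (intro vector_field_add vector_field_scaleR atlas vector_field_scaleR_const vector_field_P
      smooth_fun_g smooth_fun_eta vector_field_xi)

lemma connection_P:
  assumes X: "vector_field A X" and Y: "vector_field A Y"
  shows "D X (\<lambda>q. P q (Y q)) p = P p (D X Y p) + \<beta> *\<^sub>R N p (X p) (Y p)"
proof -
  have "D X (\<lambda>q. \<phi> q (Y q)) p - \<phi> p (D X Y p) = N p (X p) (Y p)"
    using para_Sasaki_like X Y unfolding para_Sasaki_like_def N_def by blast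
  then have "D X (\<lambda>q. \<phi> q (Y q)) p = \<phi> p (D X Y p) + N p (X p) (Y p)"
    by (simp only: diff_eq_eq add.commute)
  then show ?thesis
    using X Y unfolding P_def
    by (simp add: connection_add connection_scaleR_const vector_field_scaleR_const
        vector_field_phi scaleR_add_right)
qed

definition DS :: "'m \<Rightarrow> 'e \<Rightarrow> 'e \<Rightarrow> 'e \<Rightarrow> 'e" where
  "DS q u v w = \<beta> *\<^sub>R (g q (N q u v) w *\<^sub>R \<xi> q - \<eta> q w *\<^sub>R N q u v)
     + g q (P q v) w *\<^sub>R \<phi> q u - g q (\<phi> q u) w *\<^sub>R P q v"

text \<open>Leibniz rule, where \<open>DS\<close> collects what the structure contributes:
  \<open>\<beta> N\<close> from \<open>P\<close>, \<open>\<phi> X\<close> from \<open>\<xi>\<close>,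
  and \<open>g(\<phi> X, Z)\<close> from \<open>\<eta>\<close>. Writing \<open>S\<close> as a sum
  with the factor \<open>-1\<close> lets the rules for sums and for function multiples apply
  directly.\<close>

lemma connection_S:
  assumes X: "vector_field A X" and Y: "vector_field A Y" and Z: "vector_field A Z"
  shows "D X (\<lambda>q. S q (Y q) (Z q)) p
    = S p (D X Y p) (Z p) + S p (Y p) (D X Z p) + DS p (X p) (Y p) (Z p)"
proof -
  note PY = vector_field_P[OF Y]
  note mPY = vector_field_scaleR_const[OF PY, of "-1"]
  have "D X (\<lambda>q. g q (P q (Y q)) (Z q) *\<^sub>R \<xi> q) p
      = (g p (D X (\<lambda>q. P q (Y q)) p) (Z p) + g p (P p (Y p)) (D X Z p)) *\<^sub>R \<xi> p
        + g p (P p (Y p)) (Z p) *\<^sub>R \<phi> p (X p)"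
    by (simp only: connection_leibniz[OF smooth_fun_g[OF PY Z] X vector_field_xi]
        dir_deriv_g[OF X PY Z] connection_xi[OF X])
  moreover have "D X (\<lambda>q. \<eta> q (Z q) *\<^sub>R (-1 *\<^sub>R P q (Y q))) p
      = (\<eta> p (D X Z p) + g p (\<phi> p (X p)) (Z p)) *\<^sub>R (-1 *\<^sub>R P p (Y p))
        + \<eta> p (Z p) *\<^sub>R (-1 *\<^sub>R D X (\<lambda>q. P q (Y q)) p)"
    by (simp only: connection_leibniz[OF smooth_fun_eta[OF Z] X mPY]
        dir_deriv_eta[OF X Z] connection_scaleR_const[OF X PY])
  moreover have "D X (\<lambda>q. S q (Y q) (Z q)) p
      = D X (\<lambda>q. g q (P q (Y q)) (Z q) *\<^sub>R \<xi> q) p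
        + D X (\<lambda>q. \<eta> q (Z q) *\<^sub>R (-1 *\<^sub>R P q (Y q))) p"
    unfolding S_def
    by (intro connection_add X vector_field_scaleR[OF atlas] smooth_fun_g smooth_fun_eta
        vector_field_xi PY mPY Z)
  ultimately show ?thesis
    by (simp add: connection_P[OF X Y] S_def DS_def tensor_simps algebra_simps)
qed

text \<open>The terms \<open>S(X, D Y Z)\<close> and \<open>S(Y, D X Z)\<close> occur in both
  iterated derivatives and cancel; \<open>S(D X Y, Z) - S(D Y X, Z)\<close> cancels against
  \<open>S([X,Y], Z)\<close>.\<close>

lemma curvature_D':
  assumes X: "vector_field A X" and Y: "vector_field A Y" and Z: "vector_field A Z"
  shows "curvature A D' X Y Z p = curvature A D X Y Z p
    + (DS p (X p) (Y p) (Z p) - DS p (Y p) (X p) (Z p)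
      + S p (X p) (S p (Y p) (Z p)) - S p (Y p) (S p (X p) (Z p)))"
proof -
  have DD: "D' X (D' Y Z) p = D X (D Y Z) p + S p (D X Y p) (Z p) + S p (Y p) (D X Z p)
      + DS p (X p) (Y p) (Z p) + S p (X p) (D Y Z p) + S p (X p) (S p (Y p) (Z p))"
    if "vector_field A X" "vector_field A Y" for X Y
    using that Z
    by (simp add: D'_eq S_linear connection_add vector_field_connection vector_field_S connection_S)
  show ?thesis
    by (simp add: curvature_def DD X Y D'_eq[of "lie_bracket A X Y"] lie_bracket_eq S_linear)
qed

section \<open>Scalar pairings of \<open>P\<close>, \<open>S\<close>, \<open>N\<close> and
  \<open>DS\<close>\<close>

lemma g_P: "g q (P q a) b = \<alpha> * g q a b + \<beta> * g q (\<phi> q a) b"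
  by (simp add: P_def tensor_simps)

lemma eta_P: "\<eta> q (P q a) = \<alpha> * \<eta> q a"
  by (simp add: P_def tensor_simps eta_phi)

lemma g_P_P: "g q (P q a) (P q b) = \<alpha> * \<alpha> * g q a b + 2 * \<alpha> * \<beta> * g q (\<phi> q a) b
    + \<beta> * \<beta> * (g q a b - \<eta> q a * \<eta> q b)"
  by (simp add: P_def tensor_simps g_phi_sym phi_phi g_xi algebra_simps)

lemma g_S: "g q (S q a b) w = g q (P q a) b * \<eta> q w - \<eta> q b * g q (P q a) w"
  by (simp add: S_def tensor_simps g_xi)

lemma g_P_S: "g q (P q a) (S q b w) = \<alpha> * g q (P q b) w * \<eta> q a - \<eta> q w * g q (P q a) (P q b)"
  by (simp add: S_def tensor_simps g_xi eta_P)

lemma eta_S: "\<eta> q (S q a b) = g q (P q a) b - \<alpha> * \<eta> q a * \<eta> q b"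
  by (simp add: S_def tensor_simps eta_xi eta_P)

lemma g_N: "g q (N q a b) w = - g q a b * \<eta> q w - \<eta> q b * g q a w + 2 * \<eta> q a * \<eta> q b * \<eta> q w"
  by (simp add: N_def tensor_simps g_xi)

lemma g_DS: "g q (DS q a b c) w = \<beta> * (g q (N q a b) c * \<eta> q w - \<eta> q c * g q (N q a b) w)
    + g q (P q b) c * g q (\<phi> q a) w - g q (\<phi> q a) c * g q (P q b) w"
  by (simp add: DS_def tensor_simps g_xi)

lemma trace_curvature_difference:
  assumes "orthonormal_basis_at n g \<xi> p e"
  shows "(\<Sum>i\<le>2 * n. g p (DS p (e i) u v - DS p u (e i) v + S p (e i) (S p u v) - S p u (S p (e i) v)) (e i))
    = (\<beta>\<^sup>2 - \<beta> + (1 - 2 * real n) * \<alpha>\<^sup>2) * g p u v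
      + ((2 * real n + 1) * \<beta> - \<beta>\<^sup>2 + (2 * real n - 1) * \<alpha>\<^sup>2) * (\<eta> p u * \<eta> p v)
      + ((\<alpha> * \<beta> - \<alpha>) * (2 - 2 * real n) + \<alpha>) * g p u (\<phi> p v)"
proof -
  let ?F = "\<phi> p" and ?h = "\<eta> p" and ?G = "g p"
  define c where "c = \<alpha> * ?G u v + \<beta> * ?G (?F u) v"
  \<comment> \<open>Coefficients free of \<open>a\<close> are separated from the quadratic
    expressions in \<open>a\<close>. Writing \<open>\<eta>(a)\<close> as \<open>g(\<xi>, a)\<close>
    gives every product the shape that Parseval sums; \<open>c\<close> is
    \<open>g(P u, v)\<close>.\<close>
  have summand: "?G (DS p a u v - DS p u a v + S p a (S p u v) - S p u (S p a v)) a =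
      (\<alpha> * ?G (?F u) v + \<beta> * ?h u * ?h v - \<alpha> * c + \<alpha> * \<alpha> * ?h u * ?h v) * ?G a a
      + (\<alpha> * ?G u v + 2 * \<beta> * ?G (?F u) v - \<beta> * c + \<alpha> * \<beta> * ?h u * ?h v) * ?G (?F a) a
      + (\<beta> * ?G u v + \<alpha> * c) * (?G (\<xi> p) a * ?G (\<xi> p) a)
      - (\<beta> * ?h u + \<alpha> * \<alpha> * ?h u) * (?G v a * ?G (\<xi> p) a)
      - \<alpha> * \<beta> * ?h u * (?G (?F v) a * ?G (\<xi> p) a)
      - (\<beta> * ?h v + \<alpha> * \<alpha> * ?h v) * (?G u a * ?G (\<xi> p) a)
      - \<alpha> * \<beta> * ?h v * (?G (?F u) a * ?G (\<xi> p) a)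
      + (\<alpha> * \<beta> - \<alpha>) * (?G v a * ?G (?F u) a)
      + (\<alpha> * \<beta> - \<alpha>) * (?G (?F v) a * ?G u a)
      + (\<beta> * \<beta> - 2 * \<beta>) * (?G (?F v) a * ?G (?F u) a)
      + \<alpha> * \<alpha> * (?G v a * ?G u a)" for a
  proof -
    have r: "?G a u = ?G u a" "?G a v = ?G v a" "?G v u = ?G u v"
      "?G (?F a) u = ?G (?F u) a" "?G (?F a) v = ?G (?F v) a" "?G (?F v) u = ?G (?F u) v"
      by (rule g_sym g_phi_swap)+
    \<comment> \<open>The order matters: \<open>g_P\<close> also matches
      \<open>g (P a) (S b w)\<close> and \<open>g (P a) (P b)\<close>, so it comes only after
      \<open>g_P_S\<close> and \<open>g_P_P\<close> have consumed these.\<close>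
    show ?thesis
      unfolding c_def bilinear_ladd[OF bilinear_g] bilinear_lsub[OF bilinear_g]
        g_S g_DS g_N eta_S g_xi
      unfolding g_P_S g_P_P
      unfolding g_P r
      by (simp add: algebra_simps)
  qed
  note pars = orthonormal_parseval[OF bilinear_g assms]
  \<comment> \<open>This trace brings \<open>n\<close> into the coefficients. For instance
    \<open>\<alpha>^2 g(u,v)\<close> receives \<open>-(2n+1)\<close> from the \<open>g a a\<close>
    row, and \<open>1\<close> each from the \<open>\<xi>\<close>-\<open>\<xi>\<close> row and the
    last row, giving \<open>1 - 2n\<close>.\<close>
  have tr_id: "(\<Sum>i\<le>2 * n. ?G (e i) (e i)) = 2 * real n + 1"
    using assms by (simp add: orthonormal_basis_at_def)
  have tr_phi: "(\<Sum>i\<le>2 * n. ?G (?F (e i)) (e i)) = 0"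
    using orthonormal_trace[OF bilinear_g assms linear_phi] trace_phi by simp
  have sym: "?G v u = ?G u v" "?G (?F v) u = ?G (?F u) v"
    by (rule g_sym g_phi_swap)+
  show ?thesis
    unfolding summand sum.distrib sum_subtractf sum_distrib_left[symmetric] pars tr_id tr_phi
    by (simp add: g_xi eta_xi eta_phi g_phi_phi g_phi_sym sym c_def phi_phi phi_xi
        bilinear_lzero[OF bilinear_g] bilinear_lsub[OF bilinear_g] bilinear_lmul[OF bilinear_g]
        algebra_simps power2_eq_square)
qed

lemma ricci_D':
  assumes x: "vector_field A x" and y: "vector_field A y"
  shows "ricci n A g \<xi> D' x y p =
      ricci n A g \<xi> D x y p
      + (\<beta>\<^sup>2 - \<beta> + (1 - 2 * real n) * \<alpha>\<^sup>2) * g p (x p) (y p)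
      + ((2 * real n + 1) * \<beta> - \<beta>\<^sup>2 + (2 * real n - 1) * \<alpha>\<^sup>2) * (\<eta> p (x p) * \<eta> p (y p))
      + ((\<alpha> * \<beta> - \<alpha>) * (2 - 2 * real n) + \<alpha>) * g p (x p) (\<phi> p (y p))"
proof -
  define is_frame where "is_frame E \<longleftrightarrow> (\<forall>i\<le>2 * n. vector_field A (E i)) \<and>
      orthonormal_basis_at n g \<xi> p (\<lambda>i. E i p)" for E
  define E where "E = (SOME E. is_frame E)"
  have "\<exists>E. is_frame E"
  proof -
    obtain e where e: "e 0 = \<xi> p" "span (e ` {..2 * n}) = UNIV"
      "\<And>i j. i \<le> 2 * n \<Longrightarrow> j \<le> 2 * n \<Longrightarrow> g p (e i) (e j) = (if i = j then 1 else 0)"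
    proof (rule ex_orthonormal_basis[of "g p" "2 * n" "\<xi> p"])
      show "bilinear (g p)" by (rule bilinear_g)
      show "g p u v = g p v u" for u v by (rule g_sym)
      show "0 < g p v v" if "v \<noteq> 0" for v using that by (rule g_pos)
      show "DIM('e) = Suc (2 * n)" by (simp add: dim)
      show "g p (\<xi> p) (\<xi> p) = 1" by (simp add: g_xi eta_xi)
    qed (rule that)
    have "\<exists>X. vector_field A X \<and> X p = e i" for i
      by (rule ex_vector_field[OF atlas, of p "e i"]) blast
    then obtain E where "\<And>i. vector_field A (E i)" "\<And>i. E i p = e i"
      by metis
    then show ?thesis
      using e by (intro exI[of _ E]) (simp add: is_frame_def orthonormal_basis_at_def)
  qed
  then have "is_frame E"
    unfolding E_def by (rule someI_ex)
  then have E: "\<And>i. i \<le> 2 * n \<Longrightarrow> vector_field A (E i)"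
    "orthonormal_basis_at n g \<xi> p (\<lambda>i. E i p)"
    by (auto simp: is_frame_def)
  have ricci_eq: "ricci n A g \<xi> C x y p = (\<Sum>i\<le>2 * n. curvature4 A g C (E i) x y (E i) p)" for C
    by (simp add: ricci_def E_def is_frame_def Let_def)
  \<comment> \<open>Subtracting first cancels the curvature of \<open>D\<close> termwise; the rest
    sees the frame fields only through their values \<open>E i p\<close>.\<close>
  have "ricci n A g \<xi> D' x y p - ricci n A g \<xi> D x y p =
    (\<Sum>i\<le>2 * n. g p (DS p (E i p) (x p) (y p) - DS p (x p) (E i p) (y p)
      + S p (E i p) (S p (x p) (y p)) - S p (x p) (S p (E i p) (y p))) (E i p))"
    unfolding ricci_eq sum_subtractf[symmetric] curvature4_def
    by (rule sum.cong) (simp_all add: curvature_D' E(1) x y bilinear_ladd[OF bilinear_g])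
  then show ?thesis
    using trace_curvature_difference[OF E(2), of "x p" "y p"] by linarith
qed

end

end

theorem theorem4:
  fixes A :: "('m::{t2_space, second_countable_topology}, 'e::euclidean_space) chart set"
    and \<phi> :: "'m \<Rightarrow> 'e \<Rightarrow> 'e" and \<xi> :: "'m \<Rightarrow> 'e" and \<eta> :: "'m \<Rightarrow> 'e \<Rightarrow> real"
    and g :: "'m \<Rightarrow> 'e \<Rightarrow> 'e \<Rightarrow> real"
    and D :: "('m, 'e) connection" and \<alpha> \<beta> :: real and n :: nat
    and x y :: "'m \<Rightarrow> 'e" and p :: 'm
  assumes "apapR_manifold n A \<phi> \<xi> \<eta> g"
    and "levi_civita A g D"
    and "para_Sasaki_like A \<phi> \<xi> \<eta> g D"
    and "vector_field A x" and "vector_field A y"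
  shows "ricci n A g \<xi> (gen_sym_metric_connection \<phi> \<xi> \<eta> g D \<alpha> \<beta>) x y p =
      ricci n A g \<xi> D x y p
      + (\<beta>\<^sup>2 - \<beta> + (1 - 2 * real n) * \<alpha>\<^sup>2) * g p (x p) (y p)
      + ((2 * real n + 1) * \<beta> - \<beta>\<^sup>2 + (2 * real n - 1) * \<alpha>\<^sup>2) * (\<eta> p (x p) * \<eta> p (y p))
      + ((\<alpha> * \<beta> - \<alpha>) * (2 - 2 * real n) + \<alpha>) * g p (x p) (\<phi> p (y p))"
proof -
  interpret para_Sasaki_like_manifold n A \<phi> \<xi> \<eta> g D
    using assms(1-3) by unfold_locales
  show ?thesis by (rule ricci_D'[OF assms(4,5)])
qed

end
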